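(* Let $k$ and $r$ be positive integers with $k>r$, $\gcd(2k,r)\in\{1,2\}$ and $\gcd(2k,k-r)=1$. Let $g,h,u,v,i,j$ be integers with $g+h=S_1>0$, $g-h=D_1$, $u+v=S_2>0$, $u-v=D_2$, $i+j=S_3>0$, $i-j=D_3$, $S_1=S_2$ and $2S_1=r(k-r)S_3$. Let $\epsilon_1,\epsilon_2,\epsilon_3\in\{-1,1\}$ and $\delta_i=\frac{1-\epsilon_i}{2}$ for $i=1,2,3$. Then for every complex $q$ with $0<|q|<1$, $$\begin{aligned} &f(\epsilon_1q^g,\epsilon_1q^h)\,f(\epsilon_2q^u,\epsilon_2q^v)\,f(\epsilon_3q^i,\epsilon_3q^j)\\ &= f_{\delta_1+\delta_2}\!\left(q^{(r(k-r)S_3+D_1-D_2)/2},\,q^{(r(k-r)S_3-D_1+D_2)/2}\right)\sum_{\alpha=\left[\frac{2-k}{2}\right]}^{\left[\frac{k}{2}\right]}(-1)^{\alpha\delta_3}q^{\alpha(\alpha S_3+D_3)/2}\\ &\quad\times f_{\delta_1+\delta_2+r\delta_3}\!\left(q^{(r(S_3(k+2\alpha)+D_3)+D_1+D_2)/2},\,q^{(r(S_3(k-2\alpha)-D_3)-D_1-D_2)/2}\right)\\ &\quad\times f_{\delta_1+\delta_2+\delta_3}\!\left(q^{((k-r)(S_3(k-2\alpha)-D_3)+D_1+D_2)/2},\,q^{((k-r)(S_3(k+2\alpha)+D_3)-D_1-D_2)/2}\right)\\ &+(-1)^{\delta_3(k-r+1)/2}f_{\delta_1+\delta_2}\!\left(q^{(2r(k-r)S_3+D_1-D_2)/2},\,q^{(-D_1+D_2)/2}\right)\\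 &\times\Bigg\{\sum_{\alpha=1}^{\left[\frac{k+1}{2}\right]}(-1)^{\alpha\delta_3+\delta_1}q^{\left(S_1+D_1+\frac14S_3(-k+r+2\alpha-1)^2+\frac12D_3(-k+r+2\alpha-1)\right)/2}\\ &\quad\times f_{\delta_1+\delta_2+r\delta_3}\!\left(q^{(r(S_3(k+2\alpha-1)+D_3)+D_1+D_2)/2},\,q^{(r(S_3(k-2\alpha+1)-D_3)-D_1-D_2)/2}\right)\\ &\quad\times f_{\delta_1+\delta_2+\delta_3}\!\left(q^{((k-r)(S_3(2k-2\alpha+1)-D_3)+D_1+D_2)/2},\,q^{((k-r)(S_3(2\alpha-1)+D_3)-D_1-D_2)/2}\right)\\ &\;+\sum_{\alpha=1}^{\left[\frac{k}{2}\right]}(-1)^{\alpha\delta_3+\delta_2}q^{\left(S_2-D_2+\frac14S_3(k-r-2\alpha+1)^2+\frac12D_3(k-r-2\alpha+1)\right)/2}\\ &\quad\times f_{\delta_1+\delta_2+r\delta_3}\!\left(q^{(r(S_3(k-2\alpha+1)+D_3)+D_1+D_2)/2},\,q^{(r(S_3(k+2\alpha-1)-D_3)-D_1-D_2)/2}\right)\\ &\quad\times f_{\delta_1+\delta_2+\delta_3}\!\left(q^{((k-r)(S_3(2\alpha-1)-D_3)+D_1+D_2)/2},\,q^{((k-r)(S_3(2k-2\alpha+1)+D_3)-D_1-D_2)/2}\right)\Bigg\}. \end{aligned}$$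
   Context: Ramanujan's general theta function is $f(a,b)=\sum_{n=-\infty}^{\infty}a^{n(n+1)/2}b^{n(n-1)/2}$ for $|ab|<1$. For an integer $\delta$, $f_\delta(a,b)=f(a,b)$ if $\delta\equiv0\pmod 2$ and $f_\delta(a,b)=f(-a,-b)$ if $\delta\equiv1\pmod2$. $[x]$ denotes the greatest integer less than or equal to $x$. *)

theory Defs
  imports "HOL-Analysis.Analysis"
begin

text \<open>
  The bilateral series converges absolutely for \<open>norm (a * b) < 1\<close>, which is the only range in
  which this function is used; \<open>n * (n + 1)\<close> and \<open>n * (n - 1)\<close> are even and nonnegative, so the
  divisions are exact and the powers are ordinary ones.
\<close>
definition ramanujan_theta :: "complex \<Rightarrow> complex \<Rightarrow> complex" where
  "ramanujan_theta a b =
     (\<Sum>\<^sub>\<infinity>n\<in>(UNIV :: int set). a powi (n * (n + 1) div 2) * b powi (n * (n - 1) div 2))"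

definition ramanujan_theta_sgn :: "int \<Rightarrow> complex \<Rightarrow> complex \<Rightarrow> complex" where
  "ramanujan_theta_sgn \<delta> a b =
     (if even \<delta> then ramanujan_theta a b else ramanujan_theta (- a) (- b))"

text \<open>
  In the main statement every power of \<open>q\<close> and of \<open>-1\<close> has an integer exponent, although it is
  written as a fraction. The following facts show that each integer division by which such a
  fraction is rendered there is exact, so that nothing is rounded.
\<close>
lemma exponents_integral:
  fixes k r g h u v i j S1 D1 S2 D2 S3 D3 \<alpha> X :: int
  assumes "gcd (2 * k) (k - r) = 1"
    and "g + h = S1" "g - h = D1" "u + v = S2" "u - v = D2" "i + j = S3" "i - j = D3"
    and "S1 = S2" "2 * S1 = r * (k - r) * S3"
  shows "even (r * (k - r) * S3 + D1 - D2)"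
    and "even (r * (k - r) * S3 - D1 + D2)"
    and "even (2 * r * (k - r) * S3 + D1 - D2)"
    and "even (- D1 + D2)"
    and "even (k - r + 1)"
    and "even (\<alpha> * (\<alpha> * S3 + D3))"
    and "even (r * (S3 * (k + 2 * \<alpha>) + D3) + D1 + D2)"
    and "even (r * (S3 * (k - 2 * \<alpha>) - D3) - D1 - D2)"
    and "even ((k - r) * (S3 * (k - 2 * \<alpha>) - D3) + D1 + D2)"
    and "even ((k - r) * (S3 * (k + 2 * \<alpha>) + D3) - D1 - D2)"
    and "even (r * (S3 * (k + 2 * \<alpha> - 1) + D3) + D1 + D2)"
    and "even (r * (S3 * (k - 2 * \<alpha> + 1) - D3) - D1 - D2)"
    and "even (r * (S3 * (k - 2 * \<alpha> + 1) + D3) + D1 + D2)"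
    and "even (r * (S3 * (k + 2 * \<alpha> - 1) - D3) - D1 - D2)"
    and "even ((k - r) * (S3 * (2 * k - 2 * \<alpha> + 1) - D3) + D1 + D2)"
    and "even ((k - r) * (S3 * (2 * \<alpha> - 1) + D3) - D1 - D2)"
    and "even ((k - r) * (S3 * (2 * \<alpha> - 1) - D3) + D1 + D2)"
    and "even ((k - r) * (S3 * (2 * k - 2 * \<alpha> + 1) + D3) - D1 - D2)"
    and "X \<in> {- k + r + 2 * \<alpha> - 1, k - r - 2 * \<alpha> + 1} \<Longrightarrow> 4 dvd S3 * X\<^sup>2"
    and "X \<in> {- k + r + 2 * \<alpha> - 1, k - r - 2 * \<alpha> + 1} \<Longrightarrow> even (D3 * X)"
    and "X \<in> {- k + r + 2 * \<alpha> - 1, k - r - 2 * \<alpha> + 1} \<Longrightarrow>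
      even (S1 + D1 + S3 * X\<^sup>2 div 4 + D3 * X div 2)"
    and "X \<in> {- k + r + 2 * \<alpha> - 1, k - r - 2 * \<alpha> + 1} \<Longrightarrow>
      even (S2 - D2 + S3 * X\<^sup>2 div 4 + D3 * X div 2)"
proof -
  have odd: "odd (k - r)"
    using assms(1) by (metis dvd_triv_left gcd_greatest odd_one)
  have "even (r * (k - r) * S3)"
    using assms(9) by (metis dvd_triv_left)
  with odd have ev: "even r \<or> even S3" by simp
  have D3: "even D3 \<longleftrightarrow> even S3"
    using assms(6,7) by (metis even_add even_diff)
  have D: "even D1 \<longleftrightarrow> even D2"
    using assms by (metis even_add even_diff)
  note facts = odd ev D3 D
  show "even (r * (k - r) * S3 + D1 - D2)" "even (r * (k - r) * S3 - D1 + D2)"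
    "even (2 * r * (k - r) * S3 + D1 - D2)" "even (- D1 + D2)" "even (k - r + 1)"
    "even (\<alpha> * (\<alpha> * S3 + D3))"
    "even (r * (S3 * (k + 2 * \<alpha>) + D3) + D1 + D2)"
    "even (r * (S3 * (k - 2 * \<alpha>) - D3) - D1 - D2)"
    "even ((k - r) * (S3 * (k - 2 * \<alpha>) - D3) + D1 + D2)"
    "even ((k - r) * (S3 * (k + 2 * \<alpha>) + D3) - D1 - D2)"
    "even (r * (S3 * (k + 2 * \<alpha> - 1) + D3) + D1 + D2)"
    "even (r * (S3 * (k - 2 * \<alpha> + 1) - D3) - D1 - D2)"
    "even (r * (S3 * (k - 2 * \<alpha> + 1) + D3) + D1 + D2)"
    "even (r * (S3 * (k + 2 * \<alpha> - 1) - D3) - D1 - D2)"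
    "even ((k - r) * (S3 * (2 * k - 2 * \<alpha> + 1) - D3) + D1 + D2)"
    "even ((k - r) * (S3 * (2 * \<alpha> - 1) + D3) - D1 - D2)"
    "even ((k - r) * (S3 * (2 * \<alpha> - 1) - D3) + D1 + D2)"
    "even ((k - r) * (S3 * (2 * k - 2 * \<alpha> + 1) + D3) - D1 - D2)"
    using facts by auto
  assume "X \<in> {- k + r + 2 * \<alpha> - 1, k - r - 2 * \<alpha> + 1}"
  with odd have "even X" by auto
  then obtain m where X: "X = 2 * m" by (elim evenE)
  show "4 dvd S3 * X\<^sup>2" "even (D3 * X)"
    by (simp_all add: X power_mult_distrib)
  have "S3 * X\<^sup>2 div 4 = S3 * m\<^sup>2" "D3 * X div 2 = D3 * m"
    by (simp_all add: X power_mult_distrib)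
  moreover have "even (S1 + D1)" "even (S2 - D2)"
    using assms(2-5) by auto
  ultimately show "even (S1 + D1 + S3 * X\<^sup>2 div 4 + D3 * X div 2)"
    "even (S2 - D2 + S3 * X\<^sup>2 div 4 + D3 * X div 2)"
    using D3 by auto
qed

end

theory Submission
  imports Defs
begin

text \<open>
  Each theta function is a sum over \<open>n\<close> of \<open>\<plusminus>1\<close> to the \<open>n\<close> times \<open>t\<close> to the \<open>S n\<^sup>2 + D n\<close>,
  where \<open>t\<^sup>2 = q\<close>. The substitution \<open>(b, z) = (m + n, \<alpha> + p m - s n)\<close>, with \<open>\<alpha>\<close> running
  over a complete residue system modulo \<open>p + s\<close>, diagonalises the quadratic form
  \<open>p s b\<^sup>2 + z\<^sup>2\<close> and is a bijection onto the pairs of integers, because \<open>z + s b\<close> is congruent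
  to \<open>\<alpha>\<close>. It turns a product of two theta functions into a sum of \<open>p + s\<close> such products. With
  \<open>p = s = 1\<close> it splits the product of the first two factors into two products; with \<open>p = r\<close> and
  \<open>s = k - r\<close> it is then applied to the third factor and one factor of each of those products.
  For the second of those products the residues are shifted by \<open>(k - r + 1) / 2\<close>, and those with
  \<open>\<alpha> \<le> 0\<close> give the last sum of the theorem after a shift of one summation index.
\<close>

section \<open>Summation over the integers and over product sets\<close>

lemma summable_on_abs_geometric:
  fixes c :: real
  assumes "0 < c" "c < 1"
  shows "(\<lambda>n::int. c ^ nat \<bar>n\<bar>) summable_on UNIV"
proof -
  have geo: "(\<lambda>n. c ^ n) summable_on UNIV"
    using assms by (simp add: summable_on_UNIV_nonneg_real_iff)
  have "(\<lambda>n::int. c ^ nat \<bar>n\<bar>) summable_on range int"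
    by (subst summable_on_reindex) (use geo in \<open>auto simp: o_def\<close>)
  moreover have "(\<lambda>n::int. c ^ nat \<bar>n\<bar>) summable_on range (\<lambda>n. - int n)"
    by (subst summable_on_reindex) (use geo in \<open>auto simp: o_def inj_on_def\<close>)
  ultimately have "(\<lambda>n::int. c ^ nat \<bar>n\<bar>) summable_on range int \<union> range (\<lambda>n. - int n)"
    by (rule summable_on_union)
  also have "range int \<union> range (\<lambda>n. - int n) = UNIV"
    by (auto simp: image_iff) (metis int_cases2)
  finally show ?thesis .
qed

text \<open>Absolute summability of both factors gives absolute summability on the product set, so
  the double sum may be iterated. It serves to pass from a product of two theta series to one double
  series and back.\<close>

lemma
  fixes f :: "'a \<Rightarrow> 'c :: {real_normed_field, banach}" and g :: "'b \<Rightarrow> 'c"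
  assumes f: "(\<lambda>x. norm (f x)) summable_on A" and g: "(\<lambda>y. norm (g y)) summable_on B"
  shows summable_on_mult_Times: "(\<lambda>(x, y). f x * g y) summable_on A \<times> B"
    and infsum_mult_Times: "infsum (\<lambda>(x, y). f x * g y) (A \<times> B) = infsum f A * infsum g B"
proof -
  have "(\<lambda>p. norm ((\<lambda>(x, y). f x * g y) p)) summable_on A \<times> B"
    using f g
    by (auto simp: Infinite_Sum.abs_summable_on_Sigma_iff norm_mult infsum_cmult_right' infsum_nonneg
        intro!: summable_on_cmult_right summable_on_cmult_left)
  then show *: "(\<lambda>(x, y). f x * g y) summable_on A \<times> B"
    by (rule Infinite_Sum.abs_summable_summable)
  show "infsum (\<lambda>(x, y). f x * g y) (A \<times> B) = infsum f A * infsum g B"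
    using infsum_Sigma_banach[OF *]
    by (simp add: infsum_cmult_right' infsum_cmult_left')
qed

section \<open>Theta series in a square root of the nome and their convergence\<close>

text \<open>
  The base is a square root of the nome \<open>q\<close>, so that the half-integral exponents of the theta
  functions need no division.
\<close>
definition theta_term :: "complex \<Rightarrow> int \<Rightarrow> int \<Rightarrow> int \<Rightarrow> int \<Rightarrow> complex" where
  "theta_term t \<delta> S D n = (-1) powi (\<delta> * n) * t powi (S * n\<^sup>2 + D * n)"

definition theta :: "complex \<Rightarrow> int \<Rightarrow> int \<Rightarrow> int \<Rightarrow> complex" where
  "theta t \<delta> S D = (\<Sum>\<^sub>\<infinity>n. theta_term t \<delta> S D n)"

text \<open>Supplies a geometric majorant for theta series. As S >= 1, it reduces to x^2 - c x + c^2
  >= 0 with x = |n| and c = |D| + 1; the constant is crude but independent of n.\<close>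

lemma quadratic_ge_abs:
  fixes S D n :: int
  assumes "S > 0"
  shows "\<bar>n\<bar> \<le> S * n\<^sup>2 + D * n + (\<bar>D\<bar> + 1)\<^sup>2"
proof -
  have "n\<^sup>2 \<le> S * n\<^sup>2"
    using mult_right_mono[of 1 S "n\<^sup>2"] assms by simp
  moreover have "- (\<bar>D\<bar> * \<bar>n\<bar>) \<le> D * n"
    by (metis abs_ge_minus_self abs_mult minus_le_iff)
  moreover have "0 \<le> n\<^sup>2 - (\<bar>D\<bar> + 1) * \<bar>n\<bar> + (\<bar>D\<bar> + 1)\<^sup>2"
  \<comment> \<open>In each case the mixed product is at most the square of the larger
    number.\<close>
  proof (cases "\<bar>n\<bar> \<le> \<bar>D\<bar> + 1")
    case True
    then have "(\<bar>D\<bar> + 1) * \<bar>n\<bar> \<le> (\<bar>D\<bar> + 1) * (\<bar>D\<bar> + 1)"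
      by (intro mult_left_mono) auto
    then show ?thesis
      using zero_le_power2[of n] unfolding power2_eq_square by linarith
  next
    case False
    then have "(\<bar>D\<bar> + 1) * \<bar>n\<bar> \<le> \<bar>n\<bar> * \<bar>n\<bar>"
      by (intro mult_right_mono) auto
    then show ?thesis
      using zero_le_power2[of "\<bar>D\<bar> + 1"] unfolding power2_eq_square by simp
  qed
  ultimately show ?thesis
    by (simp add: distrib_right)
qed

lemma abs_summable_theta_term:
  assumes "0 < norm t" "norm t < 1" "S > 0"
  shows "(\<lambda>n. norm (theta_term t \<delta> S D n)) summable_on UNIV"
proof (rule summable_on_comparison_test)
  show "(\<lambda>n. norm t powi (- (\<bar>D\<bar> + 1)\<^sup>2) * norm t ^ nat \<bar>n\<bar>) summable_on UNIV"
    by (intro summable_on_cmult_right summable_on_abs_geometric assms)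
  fix n :: int
  have "norm (theta_term t \<delta> S D n) = norm t powi (S * n\<^sup>2 + D * n)"
    by (simp add: theta_term_def norm_mult norm_power_int)
  \<comment> \<open>As \<open>norm t < 1\<close>, a larger exponent gives a smaller power.\<close>
  also have "\<dots> \<le> norm t powi (\<bar>n\<bar> - (\<bar>D\<bar> + 1)\<^sup>2)"
    using assms quadratic_ge_abs[of S n D] by (intro power_int_decreasing) auto
  also have "\<dots> = norm t powi (- (\<bar>D\<bar> + 1)\<^sup>2) * norm t ^ nat \<bar>n\<bar>"
    using assms by (simp add: power_int_diff power_int_minus power_int_nonneg_exp field_simps)
  finally show "norm (theta_term t \<delta> S D n) \<le> \<dots>" .
qed auto

section \<open>Parity, reflection and index shift\<close>

lemma minus_one_powi_cong:
  assumes "even (m - n)"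
  shows "(-1) powi m = ((-1) powi n :: 'a :: division_ring)"
  using assms by (auto simp: power_int_minus_left)

lemma theta_even_cong:
  assumes "even (\<delta> - \<delta>')"
  shows "theta t \<delta> S D = theta t \<delta>' S D"
proof -
  have "(-1) powi (\<delta> * n) = ((-1) powi (\<delta>' * n) :: complex)" for n
    using assms by (intro minus_one_powi_cong) (auto simp: even_mult_iff)
  then show ?thesis
    by (simp add: theta_def theta_term_def)
qed

lemma theta_minus:
  "theta t \<delta> S (- D) = theta t \<delta> S D"
  unfolding theta_def
  by (rule infsum_reindex_bij_witness[where i = uminus and j = uminus])
    (auto simp: theta_term_def power_int_minus_left)

text \<open>Replacing n by n + 1 moves D by 2 S at the cost of a monomial. This shift brings the
  last sum of the theorem into the form given by the product formula.\<close>

lemma theta_shift: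
  assumes "t \<noteq> 0"
  shows "theta t \<delta> S D = (-1) powi \<delta> * t powi (S + D) * theta t \<delta> S (D + 2 * S)"
proof -
  have "theta t \<delta> S D = (\<Sum>\<^sub>\<infinity>n. theta_term t \<delta> S D (n + 1))"
    unfolding theta_def
    by (rule infsum_reindex_bij_witness[where i = "\<lambda>n. n + 1" and j = "\<lambda>n. n - 1"]) auto
  moreover have "theta_term t \<delta> S D (n + 1)
      = (-1) powi \<delta> * t powi (S + D) * theta_term t \<delta> S (D + 2 * S) n" for n
    using assms by (simp add: theta_term_def power2_eq_square algebra_simps flip: power_int_add)
  ultimately show ?thesis
    by (simp add: theta_def infsum_cmult_right')
qed

section \<open>Ramanujan's function as a theta series\<close>

text \<open>With A = 2 a and B = 2 b, the exponent of t is a n (n + 1) + b n (n - 1) = (a + b) n^2 +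
  (a - b) n. Negating both arguments contributes (-1)^(n^2) = (-1)^n.\<close>

lemma ramanujan_theta_sgn_eq_theta:
  assumes "q = t\<^sup>2" "t \<noteq> 0" "even A" "even B" "A + B = 2 * S" "A - B = 2 * D"
  shows "ramanujan_theta_sgn \<delta> (q powi (A div 2)) (q powi (B div 2)) = theta t \<delta> S D"
proof -
  obtain a b where [simp]: "A = 2 * a" "B = 2 * b"
    using assms(3,4) by (auto elim!: evenE)
  have S: "S = a + b" "D = a - b"
    using assms(5,6) by auto
  have q: "q powi m = t powi (2 * m)" for m
    using assms(1) by (simp add: power_int_power)
  \<comment> \<open>The two signs are treated at once: \<open>c\<close> will be 1 or -1.\<close>
  have "(c * q powi a) powi (n * (n + 1) div 2) * (c * q powi b) powi (n * (n - 1) div 2)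
      = c powi (n\<^sup>2) * t powi (S * n\<^sup>2 + D * n)" if "c \<noteq> 0" for c :: complex and n
  proof -
    obtain x where x: "n * (n + 1) = 2 * x" by (metis evenE even_mult_iff even_plus_one_iff)
    then have y: "n * (n - 1) = 2 * (x - n)" by (simp add: algebra_simps)
    have n2: "n\<^sup>2 = 2 * x - n" using x by (simp add: power2_eq_square algebra_simps)
    show ?thesis
      unfolding x y S n2 q using assms(2) that
      by (simp add: power_int_mult_distrib algebra_simps flip: power_int_add power_int_mult)
  qed
  from this[of 1] this[of "-1"] show ?thesis
    by (auto simp: ramanujan_theta_sgn_def ramanujan_theta_def theta_def theta_term_def
        power_int_minus_left intro!: infsum_cong)
qed

section \<open>Product formulas for two theta series\<close>

text \<open>The cross terms cancel: p s (m + n)^2 contributes 2 p s m n and (p m - s n)^2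
  contributes -2 p s m n. The start \<open>L\<close> of the window of residues is free, which later
  allows two different ranges of summation.\<close>

lemma theta_mult_theta:
  assumes t: "0 < norm t" "norm t < 1" and pos: "p > 0" "s > 0" "S > 0"
  shows "theta t \<delta> (p * s * S) D * theta t \<delta>' S D'
    = (\<Sum>\<alpha> = L..<L + (p + s). (-1) powi (\<delta>' * \<alpha>) * t powi (S * \<alpha>\<^sup>2 + D' * \<alpha>)
         * theta t (\<delta> + p * \<delta>') (p * (p + s) * S) (D + p * (2 * S * \<alpha> + D'))
         * theta t (\<delta> - s * \<delta>') (s * (p + s) * S) (D - s * (2 * S * \<alpha> + D')))"
proof -
  define F where "F = (\<lambda>(b, z). theta_term t \<delta> (p * s * S) D b * theta_term t \<delta>' S D' z)"
  define M where "M = (\<lambda>\<alpha>. theta_term t (\<delta> + p * \<delta>') (p * (p + s) * S) (D + p * (2 * S * \<alpha> + D')))"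
  define N where "N = (\<lambda>\<alpha>. theta_term t (\<delta> - s * \<delta>') (s * (p + s) * S) (D - s * (2 * S * \<alpha> + D')))"
  define G where "G = (\<lambda>(\<alpha>, m, n). theta_term t \<delta>' S D' \<alpha> * (M \<alpha> m * N \<alpha> n))"
  have "t \<noteq> 0" using t by auto
  have F: "F summable_on UNIV" "infsum F UNIV = theta t \<delta> (p * s * S) D * theta t \<delta>' S D'"
    using summable_on_mult_Times[of "theta_term t \<delta> (p * s * S) D" UNIV "theta_term t \<delta>' S D'" UNIV]
      infsum_mult_Times[of "theta_term t \<delta> (p * s * S) D" UNIV "theta_term t \<delta>' S D'" UNIV]
      t pos
    by (simp_all add: F_def theta_def abs_summable_theta_term)
  define j where "j = (\<lambda>(\<alpha>, m, n). (m + n, \<alpha> + p * m - s * n))"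
  \<comment> \<open>The image under \<open>j\<close> satisfies z + s b = \<alpha> + (p + s) m. After
    subtracting \<open>L\<close>, the remainder is \<alpha> - L and the quotient is m; then n = b -
    m.\<close>
  define i where "i = (\<lambda>(b, z). (L + (z + s * b - L) mod (p + s), (z + s * b - L) div (p + s),
    b - (z + s * b - L) div (p + s)))"
  have eq: "F (j x) = G x" for x
  proof -
    obtain \<alpha> m n where x: "x = (\<alpha>, m, n)" by (cases x)
    have 1: "p * s * S * (m + n)\<^sup>2 + D * (m + n) + (S * (\<alpha> + p * m - s * n)\<^sup>2 + D' * (\<alpha> + p * m - s * n))
      = S * \<alpha>\<^sup>2 + D' * \<alpha> + ((p * (p + s) * S * m\<^sup>2 + (D + p * (2 * S * \<alpha> + D')) * m)
        + (s * (p + s) * S * n\<^sup>2 + (D - s * (2 * S * \<alpha> + D')) * n))"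
      by (simp add: power2_eq_square algebra_simps)
    have 2: "\<delta> * (m + n) + \<delta>' * (\<alpha> + p * m - s * n)
      = \<delta>' * \<alpha> + ((\<delta> + p * \<delta>') * m + (\<delta> - s * \<delta>') * n)"
      by (simp add: algebra_simps)
    have "F (j x) = (-1) powi (\<delta> * (m + n) + \<delta>' * (\<alpha> + p * m - s * n))
       * t powi (p * s * S * (m + n)\<^sup>2 + D * (m + n) + (S * (\<alpha> + p * m - s * n)\<^sup>2 + D' * (\<alpha> + p * m - s * n)))"
      using \<open>t \<noteq> 0\<close> by (simp add: x F_def j_def theta_term_def power_int_add)
    also have "\<dots> = G x"
      unfolding 1 2 using \<open>t \<noteq> 0\<close>
      by (simp add: x G_def M_def N_def theta_term_def power_int_add)
    finally show ?thesis .
  qed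
  have bij: "bij_betw j ({L..<L + (p + s)} \<times> UNIV) UNIV"
  proof (rule bij_betwI[where g = i])
    show "i \<in> UNIV \<rightarrow> {L..<L + (p + s)} \<times> UNIV"
      using pos by (auto simp: i_def)
    fix x assume "x \<in> {L..<L + (p + s)} \<times> (UNIV :: (int \<times> int) set)"
    then obtain \<alpha> m n where x: "x = (\<alpha>, m, n)" "L \<le> \<alpha>" "\<alpha> < L + (p + s)" by auto
    have w: "\<alpha> + p * m - s * n + s * (m + n) - L = (\<alpha> - L) + (p + s) * m"
      by (simp add: algebra_simps)
    show "i (j x) = x"
      unfolding x(1) i_def j_def using x(2,3) pos by (simp add: w)
  next
    fix y :: "int \<times> int"
    obtain b z where y: "y = (b, z)" by (cases y)
    define w where "w = z + s * b - L"
    have "L + w mod (p + s) + p * (w div (p + s)) - s * (b - w div (p + s)) = z"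
      using mult_div_mod_eq[of "p + s" w] by (simp add: w_def algebra_simps)
    then show "j (i y) = y"
      by (simp add: y i_def j_def w_def)
  qed auto
  have "infsum F UNIV = infsum G ({L..<L + (p + s)} \<times> UNIV)"
    using infsum_reindex_bij_betw[OF bij, of F] by (simp add: eq)
  \<comment> \<open>Iterating the sum needs summability of \<open>G\<close>, which is carried over
    from \<open>F\<close> along the bijection.\<close>
  also have "\<dots> = (\<Sum>\<^sub>\<infinity>\<alpha>\<in>{L..<L + (p + s)}. \<Sum>\<^sub>\<infinity>y. G (\<alpha>, y))"
    using summable_on_reindex_bij_betw[OF bij, of F] F(1)
    by (subst infsum_Sigma_banach) (simp_all add: eq)
  also have "\<dots> = (\<Sum>\<alpha> = L..<L + (p + s). \<Sum>\<^sub>\<infinity>y. G (\<alpha>, y))"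
    by simp
  moreover have "(\<Sum>\<^sub>\<infinity>y. G (\<alpha>, y)) = theta_term t \<delta>' S D' \<alpha> * (infsum (M \<alpha>) UNIV * infsum (N \<alpha>) UNIV)" for \<alpha>
    using infsum_mult_Times[of "M \<alpha>" UNIV "N \<alpha>" UNIV] t pos
    by (simp add: G_def M_def N_def abs_summable_theta_term infsum_cmult_right' case_prod_unfold)
  ultimately have "theta t \<delta> (p * s * S) D * theta t \<delta>' S D' = (\<Sum>\<alpha> = L..<L + (p + s). theta_term t \<delta>' S D' \<alpha>
      * (theta t (\<delta> + p * \<delta>') (p * (p + s) * S) (D + p * (2 * S * \<alpha> + D'))
      * theta t (\<delta> - s * \<delta>') (s * (p + s) * S) (D - s * (2 * S * \<alpha> + D'))))"
    by (simp add: F(2) theta_def M_def N_def)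
  then show ?thesis
    by (simp add: theta_term_def mult.assoc)
qed

lemma theta_mult_theta_same:
  assumes t: "0 < norm t" "norm t < 1" and "S > 0"
  shows "theta t \<delta> S D * theta t \<delta>' S D'
    = theta t (\<delta> + \<delta>') (2 * S) (D - D') * theta t (\<delta> + \<delta>') (2 * S) (D + D')
      + (-1) powi \<delta> * t powi (S + D)
        * theta t (\<delta> + \<delta>') (2 * S) (2 * S + D - D') * theta t (\<delta> + \<delta>') (2 * S) (2 * S + D + D')"
proof -
  have two: "{0..<2::int} = {0, 1}"
    by auto
  \<comment> \<open>The factors are swapped so that the monomial for \<alpha> = 1 comes from
    \<delta> and \<open>D\<close>.\<close>
  have "theta t \<delta>' S D' * theta t \<delta> S D = (\<Sum>\<alpha>\<in>{0, 1}. (-1) powi (\<delta> * \<alpha>) * t powi (S * \<alpha>\<^sup>2 + D * \<alpha>)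
         * theta t (\<delta>' + \<delta>) (2 * S) (D' + (2 * S * \<alpha> + D))
         * theta t (\<delta>' - \<delta>) (2 * S) (D' - (2 * S * \<alpha> + D)))"
    using theta_mult_theta[OF t, of 1 1 S \<delta>' D' \<delta> D 0] assms(3)
    by (simp add: two)
  \<comment> \<open>The difference of the sign parameters has the parity of their sum, and
    reflection negates the linear coefficient of the last factor.\<close>
  also have "\<dots> = (\<Sum>\<alpha>\<in>{0, 1}. (-1) powi (\<delta> * \<alpha>) * t powi (S * \<alpha>\<^sup>2 + D * \<alpha>)
         * theta t (\<delta> + \<delta>') (2 * S) (D' + (2 * S * \<alpha> + D))
         * theta t (\<delta> + \<delta>') (2 * S) (2 * S * \<alpha> + D - D'))"
    using theta_even_cong[of "\<delta>' - \<delta>" "\<delta> + \<delta>'" t] 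
       theta_minus[of t "\<delta> + \<delta>'" "2 * S" "2 * S * \<alpha> + D - D'" for \<alpha>]
    by (simp add: add.commute)
  finally show ?thesis
    by (simp add: algebra_simps)
qed

section \<open>The product of three theta functions\<close>

lemma ramanujan_theta_sign_eq_theta:
  assumes "q = t\<^sup>2" "t \<noteq> 0" "\<epsilon> \<in> {-1, 1 :: int}"
  shows "ramanujan_theta (of_int \<epsilon> * q powi a) (of_int \<epsilon> * q powi b) = theta t ((1 - \<epsilon>) div 2) (a + b) (a - b)"
  using assms(3) ramanujan_theta_sgn_eq_theta[OF assms(1,2), of "2 * a" "2 * b" "a + b" "a - b" "(1 - \<epsilon>) div 2"]
  by (auto simp: ramanujan_theta_sgn_def)

theorem theorem1p1:
  fixes k r g h u v i j S1 D1 S2 D2 S3 D3 :: int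
    and \<epsilon>1 \<epsilon>2 \<epsilon>3 \<delta>1 \<delta>2 \<delta>3 :: int
    and q :: complex
  assumes "r > 0" and "k > r"
    and "gcd (2 * k) r \<in> {1, 2}" and "gcd (2 * k) (k - r) = 1"
    and "g + h = S1" and "S1 > 0" and "g - h = D1"
    and "u + v = S2" and "S2 > 0" and "u - v = D2"
    and "i + j = S3" and "S3 > 0" and "i - j = D3"
    and "S1 = S2" and "2 * S1 = r * (k - r) * S3"
    and "\<epsilon>1 \<in> {-1, 1}" and "\<epsilon>2 \<in> {-1, 1}" and "\<epsilon>3 \<in> {-1, 1}"
    and "\<delta>1 = (1 - \<epsilon>1) div 2" and "\<delta>2 = (1 - \<epsilon>2) div 2" and "\<delta>3 = (1 - \<epsilon>3) div 2"
    and "0 < norm q" and "norm q < 1"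
  shows
    "ramanujan_theta (of_int \<epsilon>1 * q powi g) (of_int \<epsilon>1 * q powi h)
     * ramanujan_theta (of_int \<epsilon>2 * q powi u) (of_int \<epsilon>2 * q powi v)
     * ramanujan_theta (of_int \<epsilon>3 * q powi i) (of_int \<epsilon>3 * q powi j)
     = ramanujan_theta_sgn (\<delta>1 + \<delta>2)
         (q powi ((r * (k - r) * S3 + D1 - D2) div 2))
         (q powi ((r * (k - r) * S3 - D1 + D2) div 2))
       * (\<Sum>\<alpha> = (2 - k) div 2..k div 2.
            (-1) powi (\<alpha> * \<delta>3) * q powi (\<alpha> * (\<alpha> * S3 + D3) div 2)
            * ramanujan_theta_sgn (\<delta>1 + \<delta>2 + r * \<delta>3)
                (q powi ((r * (S3 * (k + 2 * \<alpha>) + D3) + D1 + D2) div 2))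
                (q powi ((r * (S3 * (k - 2 * \<alpha>) - D3) - D1 - D2) div 2))
            * ramanujan_theta_sgn (\<delta>1 + \<delta>2 + \<delta>3)
                (q powi (((k - r) * (S3 * (k - 2 * \<alpha>) - D3) + D1 + D2) div 2))
                (q powi (((k - r) * (S3 * (k + 2 * \<alpha>) + D3) - D1 - D2) div 2)))
     + (-1) powi (\<delta>3 * ((k - r + 1) div 2))
       * ramanujan_theta_sgn (\<delta>1 + \<delta>2)
           (q powi ((2 * r * (k - r) * S3 + D1 - D2) div 2))
           (q powi ((- D1 + D2) div 2))
       * ((\<Sum>\<alpha> = 1..(k + 1) div 2.
             (-1) powi (\<alpha> * \<delta>3 + \<delta>1)
             * q powi ((S1 + D1 + (S3 * (- k + r + 2 * \<alpha> - 1)\<^sup>2) div 4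
                          + (D3 * (- k + r + 2 * \<alpha> - 1)) div 2) div 2)
             * ramanujan_theta_sgn (\<delta>1 + \<delta>2 + r * \<delta>3)
                 (q powi ((r * (S3 * (k + 2 * \<alpha> - 1) + D3) + D1 + D2) div 2))
                 (q powi ((r * (S3 * (k - 2 * \<alpha> + 1) - D3) - D1 - D2) div 2))
             * ramanujan_theta_sgn (\<delta>1 + \<delta>2 + \<delta>3)
                 (q powi (((k - r) * (S3 * (2 * k - 2 * \<alpha> + 1) - D3) + D1 + D2) div 2))
                 (q powi (((k - r) * (S3 * (2 * \<alpha> - 1) + D3) - D1 - D2) div 2)))
          + (\<Sum>\<alpha> = 1..k div 2.
             (-1) powi (\<alpha> * \<delta>3 + \<delta>2)
             * q powi ((S2 - D2 + (S3 * (k - r - 2 * \<alpha> + 1)\<^sup>2) div 4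
                          + (D3 * (k - r - 2 * \<alpha> + 1)) div 2) div 2)
             * ramanujan_theta_sgn (\<delta>1 + \<delta>2 + r * \<delta>3)
                 (q powi ((r * (S3 * (k - 2 * \<alpha> + 1) + D3) + D1 + D2) div 2))
                 (q powi ((r * (S3 * (k + 2 * \<alpha> - 1) - D3) - D1 - D2) div 2))
             * ramanujan_theta_sgn (\<delta>1 + \<delta>2 + \<delta>3)
                 (q powi (((k - r) * (S3 * (2 * \<alpha> - 1) - D3) + D1 + D2) div 2))
                 (q powi (((k - r) * (S3 * (2 * k - 2 * \<alpha> + 1) + D3) - D1 - D2) div 2))))"
proof -

  \<comment> \<open>Translation of the right-hand side into theta series\<close>
  define t where "t = csqrt q"
  have q: "q = t\<^sup>2"
    by (simp add: t_def)
  have t: "0 < norm t" "norm t < 1" "t \<noteq> 0"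
    using assms(22,23) by (auto simp: t_def norm_csqrt)
  have q_half: "q powi (e div 2) = t powi e" if "even e" for e
    using that by (auto simp: q power_int_power elim!: evenE)
  note par = exponents_integral[OF assms(4,5,7,8,10,11,13,14,15)]
  \<comment> \<open>The gcd condition makes \<open>k - r\<close> odd, so the residue shift
    \<open>c\<close> is an integer.\<close>
  obtain c where "k - r + 1 = 2 * c"
    using par(5) by (elim evenE)
  then have k: "k = r + 2 * c - 1" and c: "(k - r + 1) div 2 = c" by simp_all
  have S1: "2 * S1 = r * (2 * c - 1) * S3"
    using assms(15) k by simp
  have S2: "S2 = S1"
    using assms(14) by simp
  note thetaI = ramanujan_theta_sgn_eq_theta[OF q t(3)]
  have A1: "ramanujan_theta_sgn (\<delta>1 + \<delta>2)
         (q powi ((r * (k - r) * S3 + D1 - D2) div 2))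
         (q powi ((r * (k - r) * S3 - D1 + D2) div 2)) = theta t (\<delta>1 + \<delta>2) (2 * S1) (D1 - D2)"
    by (rule thetaI[OF par(1,2)]) (use S1 in \<open>simp_all add: k algebra_simps\<close>)
  have A2: "ramanujan_theta_sgn (\<delta>1 + \<delta>2)
           (q powi ((2 * r * (k - r) * S3 + D1 - D2) div 2))
           (q powi ((- D1 + D2) div 2)) = theta t (\<delta>1 + \<delta>2) (2 * S1) (2 * S1 + D1 - D2)"
    by (rule thetaI[OF par(3,4)]) (use S1 in \<open>simp_all add: k algebra_simps\<close>)
  \<comment> \<open>These are the sign parameters of the product formula for p = r and s = k - r. As
    \<open>k - r\<close> is odd, \<nu> has the parity of \<delta>1 + \<delta>2 + \<delta>3.\<close>
  define \<mu> \<nu> where "\<mu> = \<delta>1 + \<delta>2 + r * \<delta>3" and "\<nu> = \<delta>1 + \<delta>2 - (k - r) * \<delta>3"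
  have \<nu>: "ramanujan_theta_sgn (\<delta>1 + \<delta>2 + \<delta>3) = ramanujan_theta_sgn \<nu>"
    using par(5) by (auto simp: fun_eq_iff ramanujan_theta_sgn_def \<nu>_def)
  \<comment> \<open>The two factors given by \<open>theta_mult_theta\<close>. \<open>D\<close> stays
    a parameter: both D1 + D2 and 2 S1 + D1 + D2 will be inserted.\<close>
  define M N where "M D \<alpha> = theta t \<mu> (r * k * S3) (D + r * (2 * S3 * \<alpha> + D3))"
    and "N D \<alpha> = theta t \<nu> ((k - r) * k * S3) (D - (k - r) * (2 * S3 * \<alpha> + D3))" for D \<alpha>
  define T where "T D \<alpha> = (-1) powi (\<delta>3 * \<alpha>) * t powi (S3 * \<alpha>\<^sup>2 + D3 * \<alpha>) * M D \<alpha> * N D \<alpha>" for D \<alpha>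
  have B1: "ramanujan_theta_sgn \<mu>
                (q powi ((r * (S3 * (k + 2 * \<alpha>) + D3) + D1 + D2) div 2))
                (q powi ((r * (S3 * (k - 2 * \<alpha>) - D3) - D1 - D2) div 2)) = M (D1 + D2) \<alpha>" for \<alpha>
    unfolding M_def by (rule thetaI[OF par(7,8)]) (simp_all add: algebra_simps)
  have B2: "ramanujan_theta_sgn \<nu>
                (q powi (((k - r) * (S3 * (k - 2 * \<alpha>) - D3) + D1 + D2) div 2))
                (q powi (((k - r) * (S3 * (k + 2 * \<alpha>) + D3) - D1 - D2) div 2)) = N (D1 + D2) \<alpha>" for \<alpha>
    unfolding N_def by (rule thetaI[OF par(9,10)]) (simp_all add: algebra_simps)
  \<comment> \<open>Since 2 S1 = r (2 c - 1) S3, adding 2 S1 to the linear coefficient and moving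
    the index by -c leaves r S3 (2 \<alpha> - 1).\<close>
  have C1: "ramanujan_theta_sgn \<mu>
                 (q powi ((r * (S3 * (k + 2 * \<alpha> - 1) + D3) + D1 + D2) div 2))
                 (q powi ((r * (S3 * (k - 2 * \<alpha> + 1) - D3) - D1 - D2) div 2))
     = M (2 * S1 + D1 + D2) (\<alpha> - c)" for \<alpha>
    unfolding M_def by (rule thetaI[OF par(11,12)]) (use S1 in \<open>simp_all add: k algebra_simps\<close>)
  have C2: "ramanujan_theta_sgn \<nu>
                 (q powi (((k - r) * (S3 * (2 * k - 2 * \<alpha> + 1) - D3) + D1 + D2) div 2))
                 (q powi (((k - r) * (S3 * (2 * \<alpha> - 1) + D3) - D1 - D2) div 2))
     = N (2 * S1 + D1 + D2) (\<alpha> - c)" for \<alpha>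
    unfolding N_def by (rule thetaI[OF par(15,16)]) (use S1 in \<open>simp_all add: k algebra_simps\<close>)
  have C3: "ramanujan_theta_sgn \<mu>
                 (q powi ((r * (S3 * (k - 2 * \<alpha> + 1) + D3) + D1 + D2) div 2))
                 (q powi ((r * (S3 * (k + 2 * \<alpha> - 1) - D3) - D1 - D2) div 2))
     = M (2 * S1 + D1 + D2) (1 - \<alpha> - c)" for \<alpha>
    unfolding M_def by (rule thetaI[OF par(13,14)]) (use S1 in \<open>simp_all add: k algebra_simps\<close>)
  \<comment> \<open>At the index 1 - \<alpha> - c the linear coefficient of \<open>N\<close> exceeds
    that of the given arguments by twice the quadratic coefficient; \<open>theta_shift\<close> makes
    up for it.\<close>
  have C4: "ramanujan_theta_sgn \<nu>
                 (q powi (((k - r) * (S3 * (2 * \<alpha> - 1) - D3) + D1 + D2) div 2))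
                 (q powi (((k - r) * (S3 * (2 * k - 2 * \<alpha> + 1) + D3) - D1 - D2) div 2))
     = (-1) powi \<nu> * t powi (D1 + D2 + (k - r) * (S3 * (2 * \<alpha> - 1) - D3))
       * N (2 * S1 + D1 + D2) (1 - \<alpha> - c)" for \<alpha>
  proof -
    \<comment> \<open>Half the difference of the two exponents before their division by 2.\<close>
    define D where "D = D1 + D2 + (k - r) * (S3 * (2 * \<alpha> - 1 - k) - D3)"
    have "?thesis \<longleftrightarrow> theta t \<nu> ((k - r) * k * S3) D = (-1) powi \<nu> * t powi ((k - r) * k * S3 + D)
       * theta t \<nu> ((k - r) * k * S3) (D + 2 * ((k - r) * k * S3))"
    proof (rule arg_cong2[of _ _ _ _ "(=)"])
      have "D + 2 * ((k - r) * k * S3)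
          = 2 * S1 + D1 + D2 - (k - r) * (2 * S3 * (1 - \<alpha> - c) + D3)"
        by (use S1 in \<open>simp add: D_def k algebra_simps\<close>)
      moreover have "(k - r) * k * S3 + D = D1 + D2 + (k - r) * (S3 * (2 * \<alpha> - 1) - D3)"
        by (simp add: D_def algebra_simps)
      ultimately show "(-1) powi \<nu> * t powi (D1 + D2 + (k - r) * (S3 * (2 * \<alpha> - 1) - D3))
       * N (2 * S1 + D1 + D2) (1 - \<alpha> - c) = (-1) powi \<nu> * t powi ((k - r) * k * S3 + D)
       * theta t \<nu> ((k - r) * k * S3) (D + 2 * ((k - r) * k * S3))"
        by (simp add: N_def)
    qed (rule thetaI[OF par(17,18)], simp_all add: D_def algebra_simps)
    then show ?thesis
      using theta_shift[OF t(3)] by blast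
  qed
  have E1: "q powi (\<alpha> * (\<alpha> * S3 + D3) div 2) = t powi (S3 * \<alpha>\<^sup>2 + D3 * \<alpha>)" for \<alpha>
    using q_half[OF par(6)[of \<alpha>]] by (simp add: power2_eq_square algebra_simps)
  have half: "S3 * (2 * m)\<^sup>2 div 4 = S3 * m\<^sup>2" "D3 * (2 * m) div 2 = D3 * m" for m
    by (simp_all add: power_mult_distrib)
  have E2: "q powi ((S1 + D1 + (S3 * (- k + r + 2 * \<alpha> - 1)\<^sup>2) div 4
                          + (D3 * (- k + r + 2 * \<alpha> - 1)) div 2) div 2)
     = t powi (S1 + D1 + (S3 * (\<alpha> - c)\<^sup>2 + D3 * (\<alpha> - c)))" for \<alpha>
  proof -
    \<comment> \<open>This is why the divisions by 4 and by 2 are exact.\<close>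
    have "- k + r + 2 * \<alpha> - 1 = 2 * (\<alpha> - c)" by (simp add: k)
    then show ?thesis
      using q_half[OF par(21)[of "- k + r + 2 * \<alpha> - 1" \<alpha>]]
      by (simp only: half insertI1 add.assoc)
  qed
  have E3: "q powi ((S2 - D2 + (S3 * (k - r - 2 * \<alpha> + 1)\<^sup>2) div 4
                          + (D3 * (k - r - 2 * \<alpha> + 1)) div 2) div 2)
     = t powi (S1 - D2 + (S3 * (c - \<alpha>)\<^sup>2 + D3 * (c - \<alpha>)))" for \<alpha>
  proof -
    have "k - r - 2 * \<alpha> + 1 = 2 * (c - \<alpha>)" by (simp add: k)
    then show ?thesis
      using q_half[OF par(22)[of "k - r - 2 * \<alpha> + 1" \<alpha>]]
      by (simp only: half S2 insertI1 insertI2 diff_conv_add_uminus add.assoc)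
  qed

  \<comment> \<open>Matching signs and powers in the two sums in braces\<close>
  \<comment> \<open>The summands of those two sums; \<open>Y\<close> keeps the monomial from
    \<open>C4\<close>.\<close>
  define X Y where "X \<alpha> = (-1) powi (\<alpha> * \<delta>3 + \<delta>1) * t powi (S1 + D1 + (S3 * (\<alpha> - c)\<^sup>2 + D3 * (\<alpha> - c)))
       * M (2 * S1 + D1 + D2) (\<alpha> - c) * N (2 * S1 + D1 + D2) (\<alpha> - c)"
    and "Y \<alpha> = (-1) powi (\<alpha> * \<delta>3 + \<delta>2) * t powi (S1 - D2 + (S3 * (c - \<alpha>)\<^sup>2 + D3 * (c - \<alpha>)))
       * M (2 * S1 + D1 + D2) (1 - \<alpha> - c)
       * ((-1) powi \<nu> * t powi (D1 + D2 + (k - r) * (S3 * (2 * \<alpha> - 1) - D3))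
       * N (2 * S1 + D1 + D2) (1 - \<alpha> - c))" for \<alpha>
  have F1: "(-1) powi (\<delta>3 * c) * X \<alpha>
     = (-1) powi \<delta>1 * t powi (S1 + D1) * T (2 * S1 + D1 + D2) (\<alpha> - c)" for \<alpha>
  proof -
    \<comment> \<open>The global sign compensates the index shift: the exponents differ by 2 c
      \<delta>3.\<close>
    have "(-1) powi (\<delta>3 * c + (\<alpha> * \<delta>3 + \<delta>1)) = ((-1) powi (\<delta>1 + \<delta>3 * (\<alpha> - c)) :: complex)"
      by (rule minus_one_powi_cong) (simp add: algebra_simps)
    then have s: "(-1) powi (\<delta>3 * c) * (-1) powi (\<alpha> * \<delta>3 + \<delta>1)
        = ((-1) powi \<delta>1 * (-1) powi (\<delta>3 * (\<alpha> - c)) :: complex)"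
      by (simp only: power_int_add neg_equal_0_iff_equal one_neq_zero simp_thms)
    have e: "t powi (S1 + D1 + (S3 * (\<alpha> - c)\<^sup>2 + D3 * (\<alpha> - c)))
        = t powi (S1 + D1) * t powi (S3 * (\<alpha> - c)\<^sup>2 + D3 * (\<alpha> - c))"
      using t(3) by (simp add: power_int_add)
    have "((-1) powi (\<delta>3 * c) * (-1) powi (\<alpha> * \<delta>3 + \<delta>1))
        * t powi (S1 + D1 + (S3 * (\<alpha> - c)\<^sup>2 + D3 * (\<alpha> - c)))
        * (M (2 * S1 + D1 + D2) (\<alpha> - c) * N (2 * S1 + D1 + D2) (\<alpha> - c))
      = (-1) powi \<delta>1 * t powi (S1 + D1) * T (2 * S1 + D1 + D2) (\<alpha> - c)"
      unfolding s e T_def by (simp only: mult_ac)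
    then show ?thesis
      by (simp only: X_def mult_ac)
  qed
  have F2: "(-1) powi (\<delta>3 * c) * Y \<alpha>
     = (-1) powi \<delta>1 * t powi (S1 + D1) * T (2 * S1 + D1 + D2) (1 - \<alpha> - c)" for \<alpha>
  proof -
    \<comment> \<open>The sign from \<open>theta_shift\<close> trades \<delta>2 for \<delta>1: as k
      - r = 2 c - 1, the exponents differ by 2 (\<delta>2 + \<alpha> \<delta>3).\<close>
    have "(-1) powi (\<delta>3 * c + (\<alpha> * \<delta>3 + \<delta>2) + \<nu>) = ((-1) powi (\<delta>1 + \<delta>3 * (1 - \<alpha> - c)) :: complex)"
      by (rule minus_one_powi_cong) (auto simp: \<nu>_def k algebra_simps)
    then have s: "(-1) powi (\<delta>3 * c) * (-1) powi (\<alpha> * \<delta>3 + \<delta>2) * (-1) powi \<nu>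
        = ((-1) powi \<delta>1 * (-1) powi (\<delta>3 * (1 - \<alpha> - c)) :: complex)"
      by (simp only: power_int_add neg_equal_0_iff_equal one_neq_zero simp_thms)
    \<comment> \<open>For the S3 terms this is (c - \<alpha>)^2 + (2 c - 1) (2 \<alpha> - 1) = (1 -
      \<alpha> - c)^2.\<close>
    have "S1 - D2 + (S3 * (c - \<alpha>)\<^sup>2 + D3 * (c - \<alpha>)) + (D1 + D2 + (k - r) * (S3 * (2 * \<alpha> - 1) - D3))
      = S1 + D1 + (S3 * (1 - \<alpha> - c)\<^sup>2 + D3 * (1 - \<alpha> - c))"
      by (simp add: k power2_eq_square algebra_simps)
    then have "t powi (S1 - D2 + (S3 * (c - \<alpha>)\<^sup>2 + D3 * (c - \<alpha>)))
        * t powi (D1 + D2 + (k - r) * (S3 * (2 * \<alpha> - 1) - D3))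
      = t powi (S1 + D1) * t powi (S3 * (1 - \<alpha> - c)\<^sup>2 + D3 * (1 - \<alpha> - c))"
      using t(3) by (metis power_int_add)
    then have "((-1) powi (\<delta>3 * c) * (-1) powi (\<alpha> * \<delta>3 + \<delta>2) * (-1) powi \<nu>)
        * (t powi (S1 - D2 + (S3 * (c - \<alpha>)\<^sup>2 + D3 * (c - \<alpha>)))
        * t powi (D1 + D2 + (k - r) * (S3 * (2 * \<alpha> - 1) - D3)))
        * (M (2 * S1 + D1 + D2) (1 - \<alpha> - c) * N (2 * S1 + D1 + D2) (1 - \<alpha> - c))
      = (-1) powi \<delta>1 * t powi (S1 + D1) * T (2 * S1 + D1 + D2) (1 - \<alpha> - c)"
      unfolding s T_def by (simp only: mult_ac)
    then show ?thesis
      by (simp only: Y_def mult_ac)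
  qed

  \<comment> \<open>Expansion against the third factor and assembly\<close>
  have split: "theta t (\<delta>1 + \<delta>2) (2 * S1) D * theta t \<delta>3 S3 D3 = (\<Sum>\<alpha> = L..<L + k. T D \<alpha>)" for D L
    using theta_mult_theta[OF t(1,2), of r "k - r" S3 "\<delta>1 + \<delta>2" D \<delta>3 D3 L] assms(1,2,12,15)
    by (simp add: T_def M_def N_def \<mu>_def \<nu>_def)
  have even_part: "theta t (\<delta>1 + \<delta>2) (2 * S1) (D1 + D2) * theta t \<delta>3 S3 D3
      = (\<Sum>\<alpha> = (2 - k) div 2..k div 2. T (D1 + D2) \<alpha>)"
  proof -
    \<comment> \<open>For k of either parity, the window of length k with this start ends at
      \<open>k div 2\<close>.\<close>
    have "{(2 - k) div 2..<(2 - k) div 2 + k} = {(2 - k) div 2..k div 2}"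
      by auto
    then show ?thesis
      using split by metis
  qed
  have odd_part: "theta t (\<delta>1 + \<delta>2) (2 * S1) (2 * S1 + D1 + D2) * theta t \<delta>3 S3 D3
      = (\<Sum>\<alpha> = 1..(k + 1) div 2. T (2 * S1 + D1 + D2) (\<alpha> - c))
        + (\<Sum>\<alpha> = 1..k div 2. T (2 * S1 + D1 + D2) (1 - \<alpha> - c))" (is "_ = (\<Sum>\<alpha> = _.._. ?T (\<alpha> - c)) + _")
  proof -
    \<comment> \<open>The start is chosen so that translation by c gives the range from
      \<open>1 - k div 2\<close> to \<open>(k + 1) div 2\<close>. It is cut between 0 and 1, and the
      lower piece is then reflected by \<alpha> to 1 - \<alpha>.\<close>
    have "(\<Sum>\<alpha> = 1 - k div 2 - c..<1 - k div 2 - c + k. ?T \<alpha>)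
        = (\<Sum>\<alpha>\<in>{1..(k + 1) div 2} \<union> {1 - k div 2..0}. ?T (\<alpha> - c))"
      using assms(1,2) by (intro sum.reindex_bij_witness[of _ "\<lambda>\<alpha>. \<alpha> - c" "\<lambda>\<alpha>. \<alpha> + c"]) auto
    also have "\<dots> = (\<Sum>\<alpha> = 1..(k + 1) div 2. ?T (\<alpha> - c)) + (\<Sum>\<alpha> = 1 - k div 2..0. ?T (\<alpha> - c))"
      by (intro sum.union_disjoint) auto
    also have "(\<Sum>\<alpha> = 1 - k div 2..0. ?T (\<alpha> - c)) = (\<Sum>\<alpha> = 1..k div 2. ?T (1 - \<alpha> - c))"
      by (intro sum.reindex_bij_witness[of _ "\<lambda>\<alpha>. 1 - \<alpha>" "\<lambda>\<alpha>. 1 - \<alpha>"]) auto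
    finally show ?thesis
      using split by metis
  qed
  have L: "ramanujan_theta (of_int \<epsilon>1 * q powi g) (of_int \<epsilon>1 * q powi h) = theta t \<delta>1 S1 D1"
    "ramanujan_theta (of_int \<epsilon>2 * q powi u) (of_int \<epsilon>2 * q powi v) = theta t \<delta>2 S1 D2"
    "ramanujan_theta (of_int \<epsilon>3 * q powi i) (of_int \<epsilon>3 * q powi j) = theta t \<delta>3 S3 D3"
    using ramanujan_theta_sign_eq_theta[OF q t(3)] assms by simp_all
  define P where "P = theta t (\<delta>1 + \<delta>2) (2 * S1)"
  \<comment> \<open>Only the factors with D1 + D2 are grouped with the third theta function; those
    with D1 - D2 stay outside the sums.\<close>
  have "theta t \<delta>1 S1 D1 * theta t \<delta>2 S1 D2 * theta t \<delta>3 S3 D3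
      = P (D1 - D2) * (P (D1 + D2) * theta t \<delta>3 S3 D3)
        + (-1) powi \<delta>1 * t powi (S1 + D1) * P (2 * S1 + D1 - D2)
          * (P (2 * S1 + D1 + D2) * theta t \<delta>3 S3 D3)"
    unfolding P_def theta_mult_theta_same[OF t(1,2) assms(6)] by (simp add: algebra_simps)
  also have "\<dots> = P (D1 - D2) * (\<Sum>\<alpha> = (2 - k) div 2..k div 2. T (D1 + D2) \<alpha>)
      + (-1) powi (\<delta>3 * c) * P (2 * S1 + D1 - D2) * (sum X {1..(k + 1) div 2} + sum Y {1..k div 2})"
  proof -
    have "(-1) powi \<delta>1 * t powi (S1 + D1) * (\<Sum>\<alpha> = 1..(k + 1) div 2. T (2 * S1 + D1 + D2) (\<alpha> - c))
        = (-1) powi (\<delta>3 * c) * sum X {1..(k + 1) div 2}"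
      by (simp only: sum_distrib_left F1)
    moreover have "(-1) powi \<delta>1 * t powi (S1 + D1) * (\<Sum>\<alpha> = 1..k div 2. T (2 * S1 + D1 + D2) (1 - \<alpha> - c))
        = (-1) powi (\<delta>3 * c) * sum Y {1..k div 2}"
      by (simp only: sum_distrib_left F2)
    ultimately show ?thesis
      unfolding even_part[folded P_def] odd_part[folded P_def]
      by (simp only: distrib_left mult.assoc mult.left_commute[of _ "P (2 * S1 + D1 - D2)"])
  qed
  finally show ?thesis
    unfolding L A1 A2 \<nu> \<mu>_def[symmetric] B1 B2 C1 C2 C3 C4 E1 E2 E3 c P_def[symmetric] T_def X_def Y_def
    \<comment> \<open>What is left is the order of the factors of
      \<open>\<alpha> * \<delta>3\<close> in the signs.\<close>
    by (simp only: mult.commute[of _ \<delta>3])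
qed

end
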